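(* Let $d\ge 2$ be an integer and let $p\in(0,1)$ be constant. Starting from the unit mass $\delta_\rho$ at the root $\rho$ of the $d$-ary tree $\mathbb{T}_d$, the minimum number of toppling moves needed to transport mass $p$ to distance at least $n$ from the root satisfies $$N_p(\mathbb{T}_d,B_n,\delta_\rho)=\Theta(d^n),$$ i.e. there exist constants $0<c\le C<\infty$ and $n_0$, depending only on $d$ and $p$, such that $c\,d^n\le N_p(\mathbb{T}_d,B_n,\delta_\rho)\le C\,d^n$ for all integers $n\ge n_0$.
   Context: The $d$-ary tree $\mathbb{T}_d$ is the infinite rooted tree in which every vertex has exactly $d$ children (so the root $\rho$ has degree $d$ and all other vertices have degree $d+1$). Toppling: let $G=(V,E)$ be a connected, locally finite graph, and write $y\sim v$ when $y,v$ are adjacent and $\mathcal{N}_v=\{y:y\sim v\}$. A mass distribution is a function $\mu:V\to[0,\infty)$. For a vertex $v$ with $\mu(v)>0$ and $0<m\le\mu(v)$, the toppling move $T_v^m$ topples mass $m$ at $v$ equally to its neighbours: $T_v^m\mu=\mu-m\delta_v+\frac{m}{|\mathcal{N}_v|}\sum_{y\sim v}\delta_y$. For $A\subset V$, $p>0$ and an initial mass distribution $\mu_0$, $N_p(G,A,\mu_0)$ is the minimum number of successive toppling moves needed to obtain from $\mu_0$ a mass distribution $\mu$ with $\sum_{v\notin A}\mu(v)\ge p$ (and $\infty$ if this is impossible). $B_n=\{u\in V: d_G(u,\rho)<n\}$ is the open ball of radius $n$ around $\rho$ in the graph distance $d_G$. *)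

theory Defs
  imports "HOL-Analysis.Analysis"
begin

section \<open>Simple graphs\<close>

record 'a ugraph =
  verts :: "'a set"
  edges :: "'a set set"

definition adj :: "'a ugraph \<Rightarrow> 'a rel" where
  "adj G = {(u, v). {u, v} \<in> edges G}"

definition nbhd :: "'a ugraph \<Rightarrow> 'a \<Rightarrow> 'a set" where
  "nbhd G v = {y. (y, v) \<in> adj G}"

locale connected_locally_finite_graph =
  fixes G :: "'a ugraph"
  assumes edges_two: "e \<in> edges G \<Longrightarrow> e \<subseteq> verts G \<and> card e = 2"
    and connected: "u \<in> verts G \<Longrightarrow> v \<in> verts G \<Longrightarrow> (u, v) \<in> (adj G)\<^sup>*"
    and locally_finite: "v \<in> verts G \<Longrightarrow> finite (nbhd G v)"

definition graph_dist :: "'a ugraph \<Rightarrow> 'a \<Rightarrow> 'a \<Rightarrow> enat" where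
  "graph_dist G u v = (INF k\<in>{k. (u, v) \<in> adj G ^^ k}. enat k)"

definition open_ball :: "'a ugraph \<Rightarrow> 'a \<Rightarrow> nat \<Rightarrow> 'a set" where
  "open_ball G r n = {u \<in> verts G. graph_dist G u r < enat n}"


section \<open>Toppling\<close>

text \<open>A mass distribution on the vertex set is a function on the whole type that vanishes off
  the vertex set.\<close>

definition mass_distribution :: "'a ugraph \<Rightarrow> ('a \<Rightarrow> real) \<Rightarrow> bool" where
  "mass_distribution G \<mu> \<longleftrightarrow> (\<forall>v. 0 \<le> \<mu> v) \<and> (\<forall>v. v \<notin> verts G \<longrightarrow> \<mu> v = 0)"

definition point_mass :: "'a \<Rightarrow> 'a \<Rightarrow> real" where
  "point_mass v = indicator {v}"

definition topple :: "'a ugraph \<Rightarrow> 'a \<Rightarrow> real \<Rightarrow> ('a \<Rightarrow> real) \<Rightarrow> 'a \<Rightarrow> real" where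
  "topple G v m \<mu> = (\<lambda>x. \<mu> x - m * point_mass v x
      + m / real (card (nbhd G v)) * (\<Sum>y\<in>nbhd G v. point_mass y x))"

definition toppling_move :: "'a ugraph \<Rightarrow> ('a \<Rightarrow> real) rel" where
  "toppling_move G = {(\<mu>, topple G v m \<mu>) | \<mu> v m. v \<in> verts G \<and> 0 < m \<and> m \<le> \<mu> v}"

text \<open>The sum is taken in the extended nonnegative reals, so that it is meaningful also for
  mass distributions of infinite total mass.\<close>

definition mass_outside :: "'a ugraph \<Rightarrow> 'a set \<Rightarrow> ('a \<Rightarrow> real) \<Rightarrow> ennreal" where
  "mass_outside G A \<mu> = (\<Sum>\<^sub>\<infinity>v\<in>verts G - A. ennreal (\<mu> v))"

text \<open>The infimum over the empty set is \<open>\<infinity>\<close>; over a nonempty set it is attained.\<close>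

definition toppling_number ::
  "real \<Rightarrow> 'a ugraph \<Rightarrow> 'a set \<Rightarrow> ('a \<Rightarrow> real) \<Rightarrow> enat" where
  "toppling_number p G A \<mu>\<^sub>0 =
     Inf {enat k | k. \<exists>\<mu>. (\<mu>\<^sub>0, \<mu>) \<in> toppling_move G ^^ k \<and> ennreal p \<le> mass_outside G A \<mu>}"

lemma (in connected_locally_finite_graph) toppling_move_mass_distribution:
  assumes "mass_distribution G \<mu>" "(\<mu>, \<nu>) \<in> toppling_move G"
  shows "mass_distribution G \<nu>"
proof -
  obtain v m where v: "v \<in> verts G" "0 < m" "m \<le> \<mu> v" "\<nu> = topple G v m \<mu>"
    using assms(2) unfolding toppling_move_def by auto
  have nb: "nbhd G v \<subseteq> verts G"
    using edges_two unfolding nbhd_def adj_def by auto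
  have s: "0 \<le> m / real (card (nbhd G v)) * (\<Sum>y\<in>nbhd G v. point_mass y x)" for x
    using v(2) by (intro mult_nonneg_nonneg divide_nonneg_nonneg sum_nonneg) (auto simp: point_mass_def)
  have "0 \<le> \<nu> x" for x
    using s[of x] v(3) assms(1)
    by (cases "x = v") (auto simp: v(4) topple_def point_mass_def mass_distribution_def)
  moreover have "\<nu> x = 0" if "x \<notin> verts G" for x
  proof -
    have "(\<Sum>y\<in>nbhd G v. point_mass y x) = 0"
      using nb that by (intro sum.neutral) (auto simp: point_mass_def indicator_def)
    moreover have "x \<noteq> v" using v(1) that by auto
    ultimately show ?thesis
      using that assms(1) by (simp add: v(4) topple_def point_mass_def mass_distribution_def)
  qed
  ultimately show ?thesis by (simp add: mass_distribution_def)
qed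


section \<open>The \<open>d\<close>-ary tree\<close>

text \<open>Vertices are the finite words over \<open>{0, \<dots>, d - 1}\<close>. The children of \<open>u\<close> are the words
  \<open>i # u\<close>, so a word lists the path to the root starting from the vertex itself.\<close>

definition dary_tree :: "nat \<Rightarrow> nat list ugraph" where
  "dary_tree d = \<lparr> verts = lists {..<d},
                   edges = {{u, i # u} | u i. u \<in> lists {..<d} \<and> i < d} \<rparr>"

abbreviation tree_root :: "nat list" where
  "tree_root \<equiv> []"

lemma nbhd_dary_tree_root: "nbhd (dary_tree d) tree_root = (\<lambda>i. [i]) ` {..<d}"
  by (auto simp: nbhd_def adj_def dary_tree_def doubleton_eq_iff)

lemma nbhd_dary_tree_Cons:
  assumes "i # u \<in> verts (dary_tree d)"
  shows "nbhd (dary_tree d) (i # u) = insert u ((\<lambda>j. j # i # u) ` {..<d})"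
proof -
  have i: "i < d" "u \<in> lists {..<d}" and iu: "i # u \<in> lists {..<d}"
    using assms by (auto simp: dary_tree_def)
  show ?thesis
  proof (intro equalityI subsetI)
    fix y assume "y \<in> nbhd (dary_tree d) (i # u)"
    then show "y \<in> insert u ((\<lambda>j. j # i # u) ` {..<d})"
      by (auto simp: nbhd_def adj_def dary_tree_def doubleton_eq_iff)
  next
    fix y assume "y \<in> insert u ((\<lambda>j. j # i # u) ` {..<d})"
    then consider "y = u" | j where "j < d" "y = j # i # u" by auto
    then have "\<exists>w j. {y, i # u} = {w, j # w} \<and> w \<in> lists {..<d} \<and> j < d"
    proof cases
      case 1
      then show ?thesis using i by metis
    next
      case 2
      then show ?thesis using iu by (metis insert_commute)
    qed
    then show "y \<in> nbhd (dary_tree d) (i # u)"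
      by (simp add: nbhd_def adj_def dary_tree_def)
  qed
qed

lemma card_nbhd_dary_tree:
  assumes "u \<in> verts (dary_tree d)"
  shows "card (nbhd (dary_tree d) u) = (if u = tree_root then d else d + 1)"
proof (cases u)
  case Nil
  then show ?thesis by (simp add: nbhd_dary_tree_root card_image inj_on_def)
next
  case (Cons i w)
  have "w \<notin> (\<lambda>j. j # i # w) ` {..<d}" by auto
  then show ?thesis
    using Cons assms by (simp add: nbhd_dary_tree_Cons card_image inj_on_def)
qed

lemma connected_locally_finite_dary_tree: "connected_locally_finite_graph (dary_tree d)"
proof
  fix e assume "e \<in> edges (dary_tree d)"
  then show "e \<subseteq> verts (dary_tree d) \<and> card e = 2"
    by (auto simp: dary_tree_def card_insert_if)
next
  have sym: "sym ((adj (dary_tree d))\<^sup>*)"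
    by (rule sym_rtrancl) (auto simp: sym_def adj_def insert_commute)
  have root: "(u, tree_root) \<in> (adj (dary_tree d))\<^sup>*" if "u \<in> verts (dary_tree d)" for u
    using that
  proof (induction u)
    case (Cons i u)
    then have "(i # u, u) \<in> adj (dary_tree d)" "u \<in> verts (dary_tree d)"
      by (auto simp: dary_tree_def adj_def insert_commute)
    then show ?case using Cons.IH by (meson converse_rtrancl_into_rtrancl)
  qed simp
  fix u v assume "u \<in> verts (dary_tree d)" "v \<in> verts (dary_tree d)"
  then show "(u, v) \<in> (adj (dary_tree d))\<^sup>*"
    using root sym by (meson rtrancl_trans symD)
next
  fix v assume "v \<in> verts (dary_tree d)"
  then show "finite (nbhd (dary_tree d) v)"
    by (cases v) (auto simp: nbhd_dary_tree_root nbhd_dary_tree_Cons)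
qed

end

theory Submission
  imports Defs "HOL-Library.Sublist"
begin

text \<open>Toppling mass \<open>m\<close> at \<open>v\<close> lowers the integral of a function \<open>f\<close> against the mass by \<open>m\<close>
  times the amount by which \<open>f v\<close> exceeds the mean of \<open>f\<close> over the neighbours of \<open>v\<close>.

  Lower bound: integrating a superharmonic function that imitates the probability of hitting \<open>v\<close>
  shows that a vertex at depth \<open>n - 1\<close> never holds mass more than \<open>2 / d ^ (n - 1)\<close>. Mass
  leaves the ball only by toppling such vertices, so order \<open>d ^ n\<close> topplings are needed.

  Upper bound: the random walk has an outward drift, so a suitable exponential weight on the ball
  of radius \<open>r\<close> is contracted by a constant factor when every vertex of the ball is toppled once.
  Performing a fixed number of such sweeps for each \<open>r = 1, \<dots>, n\<close> keeps the weight left inside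
  small, and the costs \<open>d ^ r\<close> form a geometric sum.\<close>

section \<open>Pairing a mass distribution with a function\<close>

text \<open>Meaningful for finite support only: the sum over an infinite support defaults to
  \<open>0\<close>.\<close>

definition mass_pairing :: "('a \<Rightarrow> real) \<Rightarrow> ('a \<Rightarrow> real) \<Rightarrow> real" where
  "mass_pairing f \<mu> = (\<Sum>x | \<mu> x \<noteq> 0. f x * \<mu> x)"

text \<open>One step of simple random walk applied to \<open>f\<close>, so
  \<open>f v - nbhd_mean G f v\<close> is the negative Laplacian.\<close>

definition nbhd_mean :: "'a ugraph \<Rightarrow> ('a \<Rightarrow> real) \<Rightarrow> 'a \<Rightarrow> real" where
  "nbhd_mean G f v = (\<Sum>y\<in>nbhd G v. f y) / real (card (nbhd G v))"

definition finite_mass :: "'a ugraph \<Rightarrow> ('a \<Rightarrow> real) \<Rightarrow> bool" where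
  "finite_mass G \<mu> \<longleftrightarrow> mass_distribution G \<mu> \<and> finite {x. \<mu> x \<noteq> 0}"

lemma finite_massD:
  assumes "finite_mass G \<mu>"
  shows "0 \<le> \<mu> x" "\<mu> x \<noteq> 0 \<Longrightarrow> x \<in> verts G" "finite {x. \<mu> x \<noteq> 0}"
  using assms by (auto simp: finite_mass_def mass_distribution_def)

lemma mass_pairing_superset:
  assumes "finite S" "\<And>x. x \<notin> S \<Longrightarrow> f x * \<mu> x = 0" "finite {x. \<mu> x \<noteq> 0}"
  shows "mass_pairing f \<mu> = (\<Sum>x\<in>S. f x * \<mu> x)"
  unfolding mass_pairing_def
  by (intro sum.mono_neutral_cong) (use assms in auto)

lemma mass_pairing_mono:
  assumes "finite_mass G \<mu>" "\<And>x. x \<in> verts G \<Longrightarrow> f x \<le> g x"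
  shows "mass_pairing f \<mu> \<le> mass_pairing g \<mu>"
  unfolding mass_pairing_def
  by (intro sum_mono mult_right_mono) (use assms finite_massD[OF assms(1)] in auto)

lemma mass_pairing_affine:
  "mass_pairing (\<lambda>x. a * f x + b * g x) \<mu> = a * mass_pairing f \<mu> + b * mass_pairing g \<mu>"
  by (simp add: mass_pairing_def sum.distrib sum_distrib_left algebra_simps)

lemma mass_pairing_ge_single:
  assumes "finite_mass G \<mu>" "\<And>x. x \<in> verts G \<Longrightarrow> 0 \<le> f x"
  shows "f v * \<mu> v \<le> mass_pairing f \<mu>"
proof (cases "\<mu> v = 0")
  case True
  have "0 \<le> mass_pairing f \<mu>"
    unfolding mass_pairing_def
    by (intro sum_nonneg mult_nonneg_nonneg) (use assms finite_massD[OF assms(1)] in auto)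
  with True show ?thesis by simp
next
  case False
  show ?thesis
    unfolding mass_pairing_def
    by (rule member_le_sum) (use assms finite_massD[OF assms(1)] False in auto)
qed

lemma finite_mass_point_mass: "v \<in> verts G \<Longrightarrow> finite_mass G (point_mass v)"
  by (auto simp: finite_mass_def mass_distribution_def point_mass_def indicator_def)

lemma mass_pairing_point_mass: "mass_pairing f (point_mass v) = f v"
  by (subst mass_pairing_superset[of "{v}"]) (auto simp: point_mass_def indicator_def)

text \<open>Finite support reduces the extended sum to a real one, so the transported mass becomes a
  pairing whose change under each move can be computed.\<close>

lemma mass_outside_eq_pairing:
  assumes "finite_mass G \<mu>"
  shows "mass_outside G A \<mu> = ennreal (mass_pairing (indicator (- A)) \<mu>)"
proof -
  let ?S = "{x. \<mu> x \<noteq> 0} - A"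
  note \<mu> = finite_massD[OF assms]
  have "mass_outside G A \<mu> = (\<Sum>\<^sub>\<infinity>x\<in>?S. ennreal (\<mu> x))"
    unfolding mass_outside_def
    by (intro infsum_cong_neutral) (use \<mu> in auto)
  also have "\<dots> = (\<Sum>x\<in>?S. ennreal (\<mu> x))"
    using \<mu>(3) by simp
  also have "\<dots> = ennreal (\<Sum>x\<in>?S. \<mu> x)"
    using \<mu>(1) by (simp add: sum_ennreal)
  also have "(\<Sum>x\<in>?S. \<mu> x) = (\<Sum>x\<in>?S. indicator (- A) x * \<mu> x)"
    by (intro sum.cong) auto
  also have "\<dots> = mass_pairing (indicator (- A)) \<mu>"
    by (rule mass_pairing_superset[symmetric]) (use \<mu>(3) in \<open>auto simp: indicator_def\<close>)
  finally show ?thesis .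
qed

text \<open>The pairing is linear in the mass, and pairing with a point mass is evaluation.\<close>

lemma (in connected_locally_finite_graph) mass_pairing_topple:
  assumes v: "v \<in> verts G" and fin: "finite {x. \<mu> x \<noteq> 0}"
  shows "finite {x. topple G v m \<mu> x \<noteq> 0}" (is ?fin)
    and "mass_pairing f (topple G v m \<mu>) = mass_pairing f \<mu> - m * (f v - nbhd_mean G f v)"
      (is ?eq)
proof -
  let ?N = "nbhd G v" and ?\<nu> = "topple G v m \<mu>"
  \<comment> \<open>One finite set containing the support both before and after the move.\<close>
  let ?S = "{x. \<mu> x \<noteq> 0} \<union> {v} \<union> ?N"
  have N: "finite ?N" using locally_finite v by simp
  have S: "finite ?S" using N fin by simp
  have "?\<nu> x = 0" if "x \<notin> ?S" for x
  proof -
    have "(\<Sum>y\<in>?N. point_mass y x) = 0"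
      using that by (intro sum.neutral) (auto simp: point_mass_def indicator_def)
    then show ?thesis using that by (auto simp: topple_def point_mass_def)
  qed
  then have out: "x \<in> ?S" if "?\<nu> x \<noteq> 0" for x using that by blast
  then have "{x. ?\<nu> x \<noteq> 0} \<subseteq> ?S" by blast
  then show ?fin using S finite_subset by blast
  have pm: "(\<Sum>x\<in>?S. f x * point_mass y x) = f y" if "y \<in> ?S" for y
  proof -
    have "(\<Sum>x\<in>?S. f x * point_mass y x) = (\<Sum>x\<in>?S. if x = y then f x else 0)"
      by (intro sum.cong) (auto simp: point_mass_def indicator_def)
    also have "\<dots> = f y" using S that by (simp only: sum.delta' sum.delta if_True)
    finally show ?thesis .
  qed
  have N_sum: "(\<Sum>x\<in>?S. f x * (\<Sum>y\<in>?N. point_mass y x)) = (\<Sum>y\<in>?N. f y)"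
  proof -
    have "(\<Sum>x\<in>?S. f x * (\<Sum>y\<in>?N. point_mass y x)) = (\<Sum>y\<in>?N. \<Sum>x\<in>?S. f x * point_mass y x)"
      unfolding sum_distrib_left by (rule sum.swap)
    also have "\<dots> = (\<Sum>y\<in>?N. f y)" by (intro sum.cong refl pm) auto
    finally show ?thesis .
  qed
  have "mass_pairing f ?\<nu> = (\<Sum>x\<in>?S. f x * ?\<nu> x)"
    by (rule mass_pairing_superset[OF S]) (use \<open>?fin\<close> out in auto)
  also have "\<dots> = (\<Sum>x\<in>?S. f x * \<mu> x) - m * (\<Sum>x\<in>?S. f x * point_mass v x)
      + m / real (card ?N) * (\<Sum>x\<in>?S. f x * (\<Sum>y\<in>?N. point_mass y x))"
  proof -
    have "f x * ?\<nu> x = f x * \<mu> x - m * (f x * point_mass v x)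
        + m / real (card ?N) * (f x * (\<Sum>y\<in>?N. point_mass y x))" for x
      unfolding topple_def by (simp only: algebra_simps)
    then show ?thesis by (simp only: sum.distrib sum_subtractf sum_distrib_left)
  qed
  also have "(\<Sum>x\<in>?S. f x * \<mu> x) = mass_pairing f \<mu>"
    by (rule mass_pairing_superset[symmetric, OF S]) (use fin in auto)
  finally show ?eq
    unfolding N_sum using pm[of v] by (simp add: nbhd_mean_def algebra_simps)
qed

lemma (in connected_locally_finite_graph) finite_mass_toppling_move:
  assumes "finite_mass G \<mu>" "(\<mu>, \<nu>) \<in> toppling_move G"
  shows "finite_mass G \<nu>"
  using assms toppling_move_mass_distribution mass_pairing_topple(1)
  by (fastforce simp: finite_mass_def toppling_move_def)

lemma (in connected_locally_finite_graph) finite_mass_relpow: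
  assumes "finite_mass G \<mu>" "(\<mu>, \<nu>) \<in> toppling_move G ^^ k"
  shows "finite_mass G \<nu>"
  using assms(2)
  by (induction k arbitrary: \<nu>) (auto simp: assms(1) intro: finite_mass_toppling_move)

text \<open>By \<open>mass_pairing_topple\<close> every move subtracts \<open>m\<close> times a
  nonnegative excess.\<close>

lemma (in connected_locally_finite_graph) superharmonic_relpow:
  assumes "finite_mass G \<mu>" "(\<mu>, \<nu>) \<in> toppling_move G ^^ k"
    and super: "\<And>v. v \<in> verts G \<Longrightarrow> nbhd_mean G f v \<le> f v"
  shows "mass_pairing f \<nu> \<le> mass_pairing f \<mu>"
  using assms(2)
proof (induction k arbitrary: \<nu>)
  case (Suc k)
  then obtain \<eta> where \<eta>: "(\<mu>, \<eta>) \<in> toppling_move G ^^ k" "(\<eta>, \<nu>) \<in> toppling_move G" by auto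
  then obtain v m where v: "v \<in> verts G" "0 < m" "\<nu> = topple G v m \<eta>"
    by (auto simp: toppling_move_def)
  have "finite {x. \<eta> x \<noteq> 0}"
    using finite_mass_relpow[OF assms(1) \<eta>(1)] by (simp add: finite_mass_def)
  moreover have "0 \<le> m * (f v - nbhd_mean G f v)" using v super[of v] by simp
  ultimately show ?case
    using Suc.IH[OF \<eta>(1)] v by (simp add: mass_pairing_topple(2))
qed simp

text \<open>Both \<open>f\<close> and \<open>-f\<close> are superharmonic. For \<open>f = 1\<close>
  this is conservation of mass.\<close>

lemma (in connected_locally_finite_graph) harmonic_relpow:
  assumes "finite_mass G \<mu>" "(\<mu>, \<nu>) \<in> toppling_move G ^^ k"
    and harm: "\<And>v. v \<in> verts G \<Longrightarrow> nbhd_mean G f v = f v"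
  shows "mass_pairing f \<nu> = mass_pairing f \<mu>"
proof (rule antisym)
  show "mass_pairing f \<nu> \<le> mass_pairing f \<mu>"
    by (rule superharmonic_relpow[OF assms(1,2)]) (simp add: harm)
  have neg: "mass_pairing (\<lambda>x. - f x) \<eta> = - mass_pairing f \<eta>" for \<eta>
    by (simp add: mass_pairing_def sum_negf)
  have "mass_pairing (\<lambda>x. - f x) \<nu> \<le> mass_pairing (\<lambda>x. - f x) \<mu>"
    by (rule superharmonic_relpow[OF assms(1,2)]) (simp add: nbhd_mean_def sum_negf flip: harm)
  then show "mass_pairing f \<mu> \<le> mass_pairing f \<nu>" by (simp add: neg)
qed

section \<open>Sweeps\<close>

text \<open>Toppling the vertices of \<open>S\<close> one after the other, each completely: a vertex can only have
  gained mass when its turn comes.\<close>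

lemma (in connected_locally_finite_graph) sweep:
  assumes "finite S" "S \<subseteq> verts G" "finite_mass G \<mu>" "\<theta> \<le> 1"
    and nonneg: "\<And>v. v \<in> verts G \<Longrightarrow> 0 \<le> f v"
    and contract: "\<And>v. v \<in> S \<Longrightarrow> nbhd_mean G f v \<le> \<theta> * f v"
  shows "\<exists>k \<nu>. k \<le> card S \<and> (\<mu>, \<nu>) \<in> toppling_move G ^^ k \<and> (\<forall>u. u \<notin> S \<longrightarrow> \<mu> u \<le> \<nu> u) \<and>
    mass_pairing f \<nu> \<le> mass_pairing f \<mu> - (1 - \<theta>) * (\<Sum>v\<in>S. f v * \<mu> v)"
  using assms(1,2) contract
proof (induction S)
  case empty
  then show ?case by (intro exI[of _ 0] exI[of _ \<mu>]) auto
next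
  case (insert w S)
  then obtain k \<eta> where k: "k \<le> card S" "(\<mu>, \<eta>) \<in> toppling_move G ^^ k"
      "\<And>u. u \<notin> S \<Longrightarrow> \<mu> u \<le> \<eta> u"
      "mass_pairing f \<eta> \<le> mass_pairing f \<mu> - (1 - \<theta>) * (\<Sum>v\<in>S. f v * \<mu> v)"
    by auto
  have w: "w \<in> verts G" using insert by simp
  have \<eta>: "finite_mass G \<eta>" using finite_mass_relpow assms(3) k(2) by blast
  note \<eta>' = finite_massD[OF \<eta>]
  have w_le: "\<mu> w \<le> \<eta> w" using k(3) insert by blast
  show ?case
  proof (cases "\<eta> w = 0")
    case True
    \<comment> \<open>An empty vertex admits no move, but it was also empty initially, so its term
      in the sum vanishes.\<close>
    then have "\<mu> w = 0" using w_le finite_massD(1)[OF assms(3), of w] by simp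
    then show ?thesis
      using k insert by (intro exI[of _ k] exI[of _ \<eta>]) auto
  next
    case False
    let ?\<nu> = "topple G w (\<eta> w) \<eta>"
    have "(\<eta>, ?\<nu>) \<in> toppling_move G"
      using False \<eta>'(1)[of w] w unfolding toppling_move_def by force
    then have steps: "(\<mu>, ?\<nu>) \<in> toppling_move G ^^ Suc k" using k(2) by auto
    have "\<eta> u \<le> ?\<nu> u" if "u \<noteq> w" for u
      using that \<eta>'(1)[of w]
      by (auto simp: topple_def point_mass_def intro!: mult_nonneg_nonneg sum_nonneg divide_nonneg_nonneg)
    then have out: "\<mu> u \<le> ?\<nu> u" if "u \<notin> insert w S" for u
      using that k(3)[of u] by (metis insertI1 insertI2 order_trans)
    have "nbhd_mean G f w \<le> \<theta> * f w" using insert by simp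
    then have "(1 - \<theta>) * f w \<le> f w - nbhd_mean G f w" by (simp add: algebra_simps)
    then have "\<eta> w * ((1 - \<theta>) * f w) \<le> \<eta> w * (f w - nbhd_mean G f w)"
      using \<eta>'(1)[of w] by (rule mult_left_mono)
    \<comment> \<open>The decrease is earned on the current mass \<open>\<eta> w\<close> and claimed
      only for the initial mass \<open>\<mu> w\<close>.\<close>
    moreover have "\<mu> w * ((1 - \<theta>) * f w) \<le> \<eta> w * ((1 - \<theta>) * f w)"
      using w_le nonneg[OF w] assms(4) by (intro mult_right_mono) auto
    ultimately have "mass_pairing f ?\<nu> \<le> mass_pairing f \<eta> - (1 - \<theta>) * (f w * \<mu> w)"
      unfolding mass_pairing_topple(2)[OF w \<eta>'(3)] by (simp add: algebra_simps)
    then have "mass_pairing f ?\<nu> \<le> mass_pairing f \<mu> - (1 - \<theta>) * (\<Sum>v\<in>insert w S. f v * \<mu> v)"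
      using k(4) insert by (simp add: algebra_simps)
    then show ?thesis
      using steps out k(1) insert by (intro exI[of _ "Suc k"] exI[of _ ?\<nu>]) auto
  qed
qed

text \<open>As \<open>f\<close> vanishes at the vertices outside \<open>S\<close>, the sum in
  \<open>sweep\<close> is the full pairing, so each sweep contracts it by
  \<open>\<theta>\<close>.\<close>

lemma (in connected_locally_finite_graph) sweep_repeat:
  assumes "finite S" "S \<subseteq> verts G" "finite_mass G \<mu>" "0 \<le> \<theta>" "\<theta> \<le> 1"
    and nonneg: "\<And>v. v \<in> verts G \<Longrightarrow> 0 \<le> f v"
    and contract: "\<And>v. v \<in> S \<Longrightarrow> nbhd_mean G f v \<le> \<theta> * f v"
    and supp: "\<And>v. v \<in> verts G \<Longrightarrow> v \<notin> S \<Longrightarrow> f v = 0"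
  shows "\<exists>k \<nu>. k \<le> s * card S \<and> (\<mu>, \<nu>) \<in> toppling_move G ^^ k \<and>
    mass_pairing f \<nu> \<le> \<theta> ^ s * mass_pairing f \<mu>"
proof (induction s)
  case 0
  show ?case by (intro exI[of _ 0] exI[of _ \<mu>]) auto
next
  case (Suc s)
  then obtain k \<nu> where k: "k \<le> s * card S" "(\<mu>, \<nu>) \<in> toppling_move G ^^ k"
      "mass_pairing f \<nu> \<le> \<theta> ^ s * mass_pairing f \<mu>" by blast
  have \<nu>: "finite_mass G \<nu>" using finite_mass_relpow assms(3) k(2) by blast
  obtain j \<eta> where j: "j \<le> card S" "(\<nu>, \<eta>) \<in> toppling_move G ^^ j"
      "mass_pairing f \<eta> \<le> mass_pairing f \<nu> - (1 - \<theta>) * (\<Sum>v\<in>S. f v * \<nu> v)"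
    using sweep[OF assms(1,2) \<nu> assms(5) nonneg contract] by blast
  have "(\<Sum>v\<in>S. f v * \<nu> v) = mass_pairing f \<nu>"
    by (rule mass_pairing_superset[symmetric, OF assms(1)])
      (use supp finite_massD[OF \<nu>] in auto)
  then have "mass_pairing f \<eta> \<le> \<theta> * mass_pairing f \<nu>" using j(3) by (simp add: algebra_simps)
  also have "\<dots> \<le> \<theta> * (\<theta> ^ s * mass_pairing f \<mu>)" using k(3) assms(4) by (rule mult_left_mono)
  finally have "mass_pairing f \<eta> \<le> \<theta> ^ Suc s * mass_pairing f \<mu>" by (simp add: mult.assoc)
  moreover have "(\<mu>, \<eta>) \<in> toppling_move G ^^ (k + j)"
    using k(2) j(2) by (auto simp: relpow_add)
  ultimately show ?case
    using k(1) j(1) by (intro exI[of _ "k + j"] exI[of _ \<eta>]) auto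
qed

section \<open>The tree\<close>

lemma verts_dary_tree [simp]: "verts (dary_tree d) = lists {..<d}"
  by (simp add: dary_tree_def)

interpretation dary: connected_locally_finite_graph "dary_tree d" for d
  by (rule connected_locally_finite_dary_tree)

lemma nbhd_mean_dary_tree_root:
  "nbhd_mean (dary_tree d) f [] = (\<Sum>i<d. f [i]) / real d"
  by (simp add: nbhd_mean_def nbhd_dary_tree_root sum.reindex card_image inj_on_def)

lemma nbhd_mean_dary_tree_Cons:
  assumes "i # u \<in> lists {..<d}"
  shows "nbhd_mean (dary_tree d) f (i # u) = (f u + (\<Sum>j<d. f (j # i # u))) / (real d + 1)"
proof -
  have "u \<notin> (\<lambda>j. j # i # u) ` {..<d}" by auto
  then show ?thesis
    using assms card_nbhd_dary_tree[of "i # u" d]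
    by (simp add: nbhd_mean_def nbhd_dary_tree_Cons sum.reindex inj_on_def add.commute)
qed

section \<open>Distances to the root and sizes of balls\<close>

lemma relpow_adj_dary_tree_length_le:
  "(u, v) \<in> adj (dary_tree d) ^^ k \<Longrightarrow> length u \<le> length v + k"
proof (induction k arbitrary: v)
  case (Suc k)
  then obtain w where "(u, w) \<in> adj (dary_tree d) ^^ k" "(w, v) \<in> adj (dary_tree d)" by auto
  moreover from this(2) have "length w \<le> Suc (length v)"
    by (auto simp: adj_def dary_tree_def doubleton_eq_iff)
  ultimately show ?case using Suc.IH by fastforce
qed simp

lemma relpow_adj_dary_tree_root:
  "u \<in> lists {..<d} \<Longrightarrow> (u, []) \<in> adj (dary_tree d) ^^ length u"
proof (induction u)
  case (Cons i u)
  then have "(i # u, u) \<in> adj (dary_tree d)"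
    by (auto simp: adj_def dary_tree_def insert_commute)
  moreover have "(u, []) \<in> adj (dary_tree d) ^^ length u" using Cons by simp
  ultimately show ?case by (metis length_Cons relpow_Suc_I2)
qed simp

text \<open>Deleting letters one by one reaches the root, and no edge shortens a word by more than
  one letter.\<close>

lemma graph_dist_dary_tree_root:
  assumes "u \<in> lists {..<d}"
  shows "graph_dist (dary_tree d) u [] = enat (length u)"
  unfolding graph_dist_def
proof (rule antisym)
  show "(INF k\<in>{k. (u, []) \<in> adj (dary_tree d) ^^ k}. enat k) \<le> enat (length u)"
    by (rule INF_lower) (use relpow_adj_dary_tree_root[OF assms] in simp)
  show "enat (length u) \<le> (INF k\<in>{k. (u, []) \<in> adj (dary_tree d) ^^ k}. enat k)"
  proof (rule INF_greatest)
    fix k assume "k \<in> {k. (u, []) \<in> adj (dary_tree d) ^^ k}"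
    then show "enat (length u) \<le> enat k"
      using relpow_adj_dary_tree_length_le[of u "[]" k d] by simp
  qed
qed

lemma open_ball_dary_tree: "open_ball (dary_tree d) [] n = {u \<in> lists {..<d}. length u < n}"
  unfolding open_ball_def verts_dary_tree
  by (intro Collect_cong conj_cong refl) (simp only: graph_dist_dary_tree_root enat_ord_simps)

lemma open_ball_dary_tree_card:
  assumes "d \<ge> 2"
  shows "finite (open_ball (dary_tree d) [] n)" "card (open_ball (dary_tree d) [] n) \<le> d ^ n"
proof -
  have eq: "open_ball (dary_tree d) [] n = (\<Union>k<n. {u. set u \<subseteq> {..<d} \<and> length u = k})"
    by (auto simp: open_ball_dary_tree lists_eq_set)
  show "finite (open_ball (dary_tree d) [] n)"
    unfolding eq by (auto simp: finite_lists_length_eq)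
  have "card (open_ball (dary_tree d) [] n) \<le> (\<Sum>k<n. d ^ k)"
    unfolding eq using card_UN_le[of "{..<n}" "\<lambda>k. {u. set u \<subseteq> {..<d} \<and> length u = k}"]
    by (simp add: card_lists_length_eq)
  also have "\<dots> \<le> d ^ n"
  proof (induction n)
    case (Suc n)
    \<comment> \<open>The levels so far and the new level are each at most
      \<open>d ^ n\<close>.\<close>
    have "2 * d ^ n \<le> d * d ^ n" using assms by (rule mult_right_mono) simp
    then show ?case using Suc unfolding sum.lessThan_Suc power_Suc by linarith
  qed simp
  finally show "card (open_ball (dary_tree d) [] n) \<le> d ^ n" .
qed

text \<open>No degree is zero, so averaging fixes constants; with \<open>harmonic_relpow\<close> the
  total mass stays \<open>1\<close>.\<close>

lemma nbhd_mean_dary_tree_const: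
  assumes "d \<ge> 2" "v \<in> lists {..<d}"
  shows "nbhd_mean (dary_tree d) (\<lambda>_. c) v = c"
proof (cases v)
  case Nil
  then show ?thesis using assms by (simp add: nbhd_mean_dary_tree_root)
next
  case (Cons i u)
  then show ?thesis
    using nbhd_mean_dary_tree_Cons[of i u d "\<lambda>_. c"] assms
    by (simp add: divide_eq_eq algebra_simps)
qed

section \<open>Upper bound\<close>

text \<open>Off the root, averaging a weight with base \<open>b > 0\<close> multiplies it by at most
  \<open>(b + d / b) / (d + 1)\<close>, which is below \<open>1\<close> exactly for
  \<open>1 < b < d\<close>; the base \<open>3 / 2\<close> serves every
  \<open>d \<ge> 2\<close>.\<close>

definition ball_weight :: "nat \<Rightarrow> nat list \<Rightarrow> real" where
  "ball_weight n u = (if length u < n then (3 / 2) ^ (n - length u) else 0)"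

text \<open>Off the root the factor is at most \<open>(3 / 2 + 2 * d / 3) / (d + 1)\<close>, which
  is largest at \<open>d = 2\<close>, with value \<open>17 / 18\<close>. The root has no parent, so
  \<open>2 / 3\<close> suffices there.\<close>

lemma nbhd_mean_ball_weight:
  assumes d: "d \<ge> 2" and v: "v \<in> open_ball (dary_tree d) [] n"
  shows "nbhd_mean (dary_tree d) (ball_weight n) v \<le> 17 / 18 * ball_weight n v"
proof -
  have lt: "length v < n" and vl: "v \<in> lists {..<d}" using v by (auto simp: open_ball_dary_tree)
  \<comment> \<open>Equality, except at the last level, where the child leaves the ball and has
    weight \<open>0\<close>.\<close>
  have child: "ball_weight n (j # v) \<le> 2 / 3 * ball_weight n v" for j
  proof -
    obtain r where "n - length v = Suc r" using lt by (metis Suc_diff_Suc)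
    then show ?thesis using lt by (auto simp: ball_weight_def)
  qed
  then have children: "(\<Sum>j<d. ball_weight n (j # v)) \<le> real d * (2 / 3 * ball_weight n v)"
    using sum_bounded_above[of "{..<d}" "\<lambda>j. ball_weight n (j # v)" "2 / 3 * ball_weight n v"]
    by simp
  have pos: "0 \<le> ball_weight n v" by (simp add: ball_weight_def)
  show ?thesis
  proof (cases v)
    case Nil
    have "(\<Sum>j<d. ball_weight n [j]) / real d \<le> 2 / 3 * ball_weight n []"
      using children d Nil by (simp add: field_simps)
    also have "\<dots> \<le> 17 / 18 * ball_weight n []" using pos Nil by (intro mult_right_mono) auto
    finally show ?thesis unfolding Nil nbhd_mean_dary_tree_root .
  next
    case (Cons i u)
    have parent: "ball_weight n u = 3 / 2 * ball_weight n v"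
      using lt Cons by (simp add: ball_weight_def Suc_diff_Suc flip: power_Suc)
    have "ball_weight n v * (3 / 2 + real d * (2 / 3)) \<le> ball_weight n v * (17 / 18 * (real d + 1))"
      using d by (intro mult_left_mono pos) (simp add: field_simps)
    then have "ball_weight n u + (\<Sum>j<d. ball_weight n (j # v)) \<le> 17 / 18 * ball_weight n v * (real d + 1)"
      using children parent by (simp add: algebra_simps)
    then show ?thesis
      using vl unfolding Cons
      by (subst nbhd_mean_dary_tree_Cons) (auto simp: pos_divide_le_eq)
  qed
qed

text \<open>The recursion \<open>R \<mapsto> (17/18)^s * (3/2 * R + 3/2)\<close> for the weight left in the growing ball maps
  \<open>[0, \<epsilon>]\<close> to itself, so a fixed number \<open>s\<close> of sweeps per radius suffices.\<close>

lemma toppling_out_of_balls: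
  assumes d: "d \<ge> 2" and \<epsilon>: "0 < \<epsilon>" "\<epsilon> \<le> 1" and s: "(17 / 18) ^ s \<le> \<epsilon> / 3"
  shows "\<exists>k \<mu>. k \<le> 2 * s * d ^ n \<and> (point_mass [], \<mu>) \<in> toppling_move (dary_tree d) ^^ k \<and>
    mass_pairing (ball_weight n) \<mu> \<le> \<epsilon>"
proof (induction n)
  case 0
  show ?case
    using \<epsilon> by (intro exI[of _ 0] exI[of _ "point_mass []"])
      (auto simp: mass_pairing_point_mass ball_weight_def)
next
  case (Suc n)
  then obtain k \<mu> where k: "k \<le> 2 * s * d ^ n"
      "(point_mass [], \<mu>) \<in> toppling_move (dary_tree d) ^^ k"
      "mass_pairing (ball_weight n) \<mu> \<le> \<epsilon>" by blast
  have fin0: "finite_mass (dary_tree d) (point_mass [])" by (rule finite_mass_point_mass) simp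
  have fin: "finite_mass (dary_tree d) \<mu>"
    using dary.finite_mass_relpow[OF fin0 k(2)] .
  have total: "mass_pairing (\<lambda>_. 1) \<mu> = 1"
    using dary.harmonic_relpow[OF fin0 k(2), of "\<lambda>_. 1"] nbhd_mean_dary_tree_const[OF d, of _ 1]
    by (simp add: mass_pairing_point_mass)
  let ?S = "open_ball (dary_tree d) [] (Suc n)"
  let ?h = "ball_weight (Suc n)"
  have "\<exists>j \<nu>. j \<le> s * card ?S \<and> (\<mu>, \<nu>) \<in> toppling_move (dary_tree d) ^^ j \<and>
    mass_pairing ?h \<nu> \<le> (17 / 18) ^ s * mass_pairing ?h \<mu>"
  proof (rule dary.sweep_repeat)
    show "finite ?S" using open_ball_dary_tree_card d by blast
    show "?S \<subseteq> verts (dary_tree d)" by (auto simp: open_ball_dary_tree)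
    show "nbhd_mean (dary_tree d) ?h v \<le> 17 / 18 * ?h v" if "v \<in> ?S" for v
      using nbhd_mean_ball_weight[OF d that] .
  qed (use fin in \<open>auto simp: ball_weight_def open_ball_dary_tree\<close>)
  then obtain j \<nu> where j: "j \<le> s * card ?S" "(\<mu>, \<nu>) \<in> toppling_move (dary_tree d) ^^ j"
    "mass_pairing ?h \<nu> \<le> (17 / 18) ^ s * mass_pairing ?h \<mu>" by blast
  \<comment> \<open>Enlarging the radius multiplies the old weights by \<open>3 / 2\<close> and
    gives the new sphere, at depth \<open>n\<close>, weight \<open>3 / 2\<close>.\<close>
  have "mass_pairing ?h \<mu> \<le> mass_pairing (\<lambda>u. 3 / 2 * ball_weight n u + 3 / 2 * 1) \<mu>"
    by (rule mass_pairing_mono[OF fin])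
      (auto simp: ball_weight_def Suc_diff_le less_Suc_eq)
  also have "\<dots> = 3 / 2 * mass_pairing (ball_weight n) \<mu> + 3 / 2"
    by (subst mass_pairing_affine) (simp add: total)
  \<comment> \<open>This \<open>3\<close> is cancelled by the bound \<open>\<epsilon> / 3\<close> on
    the contraction of \<open>s\<close> sweeps.\<close>
  also have "\<dots> \<le> 3" using k(3) \<epsilon> by simp
  finally have "(17 / 18) ^ s * mass_pairing ?h \<mu> \<le> (17 / 18) ^ s * 3"
    by (rule mult_left_mono) simp
  then have "mass_pairing ?h \<nu> \<le> \<epsilon>" using j(3) s by linarith
  moreover have "(point_mass [], \<nu>) \<in> toppling_move (dary_tree d) ^^ (k + j)"
    using k(2) j(2) by (auto simp: relpow_add)
  moreover have "k + j \<le> 2 * s * d ^ Suc n"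
  proof -
    have "s * card ?S \<le> s * d ^ Suc n"
      using open_ball_dary_tree_card(2)[OF d] by (rule mult_left_mono) simp
    \<comment> \<open>Since \<open>d \<ge> 2\<close>, the cost so far fits into half of the new
      budget; the new sweeps take the other half.\<close>
    moreover have "2 * (s * d ^ n) \<le> d * (s * d ^ n)" using d by (rule mult_right_mono) simp
    then have "2 * s * d ^ n \<le> s * d ^ Suc n" by (simp add: mult_ac)
    ultimately show ?thesis using k(1) j(1) by linarith
  qed
  ultimately show ?case by blast
qed

lemma toppling_number_le:
  assumes d: "d \<ge> 2" and p: "0 < p" "p < 1" and s: "(17 / 18) ^ s \<le> (1 - p) / 3"
  shows "toppling_number p (dary_tree d) (open_ball (dary_tree d) [] n) (point_mass [])
    \<le> enat (2 * s * d ^ n)"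
proof -
  let ?B = "open_ball (dary_tree d) [] n"
  obtain k \<mu> where k: "k \<le> 2 * s * d ^ n"
      "(point_mass [], \<mu>) \<in> toppling_move (dary_tree d) ^^ k"
      "mass_pairing (ball_weight n) \<mu> \<le> 1 - p"
    using toppling_out_of_balls[OF d _ _ s, of n] p by auto
  have fin0: "finite_mass (dary_tree d) (point_mass [])" by (rule finite_mass_point_mass) simp
  have fin: "finite_mass (dary_tree d) \<mu>"
    using dary.finite_mass_relpow[OF fin0 k(2)] .
  have "1 = mass_pairing (\<lambda>_. 1) \<mu>"
    using dary.harmonic_relpow[OF fin0 k(2), of "\<lambda>_. 1"] nbhd_mean_dary_tree_const[OF d, of _ 1]
    by (simp add: mass_pairing_point_mass)
  \<comment> \<open>Inside the ball the weight is at least \<open>1\<close>, so the mass left there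
    is at most \<open>1 - p\<close>.\<close>
  also have "\<dots> \<le> mass_pairing (\<lambda>u. 1 * indicator (- ?B) u + 1 * ball_weight n u) \<mu>"
    by (rule mass_pairing_mono[OF fin])
      (auto simp: ball_weight_def open_ball_dary_tree indicator_def)
  also have "\<dots> = mass_pairing (indicator (- ?B)) \<mu> + mass_pairing (ball_weight n) \<mu>"
    by (subst mass_pairing_affine) simp
  finally have "p \<le> mass_pairing (indicator (- ?B)) \<mu>" using k(3) by simp
  then have "ennreal p \<le> mass_outside (dary_tree d) ?B \<mu>"
    by (simp add: mass_outside_eq_pairing[OF fin] ennreal_leI)
  then have "toppling_number p (dary_tree d) ?B (point_mass []) \<le> enat k"
    unfolding toppling_number_def using k(2) by (intro Inf_lower) auto
  also have "\<dots> \<le> enat (2 * s * d ^ n)" using k(1) by simp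
  finally show ?thesis .
qed

section \<open>Lower bound\<close>

text \<open>The depth of the last common ancestor of \<open>v\<close> and a vertex.\<close>

primrec meet_depth :: "nat list \<Rightarrow> nat list \<Rightarrow> nat" where
  "meet_depth v [] = 0"
| "meet_depth v (i # u) = (if suffix (i # u) v then Suc (length u) else meet_depth v u)"

lemma meet_depth_suffix: "suffix u v \<Longrightarrow> meet_depth v u = length u"
  by (cases u) auto

text \<open>Superharmonic with value \<open>2\<close> at the root and about \<open>d ^ length v\<close> at \<open>v\<close>. The second summand
  is harmonic off the root; it is added to repair the mean value inequality at the root.\<close>

definition hit_weight :: "nat \<Rightarrow> nat list \<Rightarrow> nat list \<Rightarrow> real" where
  "hit_weight d v u = (real d ^ (2 * meet_depth v u) + 1) / real d ^ length u"

lemma hit_weight_nonneg: "0 \<le> hit_weight d v u"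
  by (simp add: hit_weight_def)

text \<open>A step down to a vertex off the path to \<open>v\<close> keeps the meeting depth, so
  only the denominator grows.\<close>

lemma hit_weight_Cons_not_suffix:
  "\<not> suffix (i # u) v \<Longrightarrow> hit_weight d v (i # u) = hit_weight d v u / real d"
  by (simp add: hit_weight_def)

lemma hit_weight_suffix:
  assumes "suffix u v" "d \<ge> 2"
  shows "hit_weight d v u = real d ^ length u + 1 / real d ^ length u"
  using assms by (simp add: hit_weight_def meet_depth_suffix power_mult power2_eq_square field_simps)

text \<open>At most one child continues towards \<open>v\<close>; every other child has value
  \<open>hit_weight d v u / d\<close>. If none continues, as at \<open>u = v\<close>, one of these
  equal terms is bounded by the larger on-path value.\<close>

lemma sum_hit_weight_children:
  assumes d: "d \<ge> 2" and u: "suffix u v"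
  shows "(\<Sum>j<d. hit_weight d v (j # u)) \<le>
    (real d ^ Suc (length u) + 1 / real d ^ Suc (length u)) + (real d - 1) / real d * hit_weight d v u"
proof -
  let ?q = "hit_weight d v u / real d"
  let ?c = "real d ^ Suc (length u) + 1 / real d ^ Suc (length u)"
  have q_le: "?q \<le> ?c"
  proof -
    have "real d ^ length u / real d \<le> real d ^ Suc (length u)"
    proof -
      have "real d ^ length u * 1 \<le> real d ^ length u * (real d * real d)"
        using d by (intro mult_left_mono) (auto simp: one_le_mult_iff mult_ge1_I)
      then show ?thesis using d by (simp add: field_simps)
    qed
    then show ?thesis
      using d by (simp add: hit_weight_suffix[OF u d] add_divide_distrib mult.commute)
  qed
  show ?thesis
  proof (cases "\<exists>i<d. suffix (i # u) v")
    case True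
    then obtain i where i: "i < d" "suffix (i # u) v" by blast
    have uniq: "j = i" if "suffix (j # u) v" for j
      using suffix_same_cases[OF that i(2)] by (auto simp: suffix_def)
    have "(\<Sum>j<d. hit_weight d v (j # u)) = hit_weight d v (i # u) + (\<Sum>j\<in>{..<d} - {i}. hit_weight d v (j # u))"
      using i by (intro sum.remove) auto
    also have "(\<Sum>j\<in>{..<d} - {i}. hit_weight d v (j # u)) = (\<Sum>j\<in>{..<d} - {i}. ?q)"
      using uniq by (intro sum.cong refl hit_weight_Cons_not_suffix) auto
    finally show ?thesis
      using i d by (simp add: hit_weight_suffix[OF i(2) d] of_nat_diff)
  next
    case False
    then have "(\<Sum>j<d. hit_weight d v (j # u)) = (\<Sum>j<d. ?q)"
      by (intro sum.cong refl hit_weight_Cons_not_suffix) auto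
    also have "\<dots> = ?q + (real d - 1) / real d * hit_weight d v u"
      using d by (simp add: field_simps)
    finally show ?thesis using q_le by linarith
  qed
qed

text \<open>Off the path to \<open>v\<close> equality holds: the parent contributes \<open>d\<close>
  times the value and the children together once. On the path below the root the bound on the
  children gives exactly \<open>d + 1\<close> times the value. At the root the claim reduces to
  \<open>(d - 1)^2 \<ge> 0\<close>.\<close>

lemma nbhd_mean_hit_weight:
  assumes d: "d \<ge> 2" and u: "u \<in> lists {..<d}"
  shows "nbhd_mean (dary_tree d) (hit_weight d v) u \<le> hit_weight d v u"
proof (cases u)
  case Nil
  have "(\<Sum>j<d. hit_weight d v [j]) \<le> (real d + 1 / real d) + (real d - 1) / real d * 2"
    using sum_hit_weight_children[OF d, of "[]" v] by (simp add: hit_weight_def)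
  also have "\<dots> \<le> 2 * real d"
  proof -
    have "0 \<le> (real d - 1) * (real d - 1)" by simp
    then have "real d * real d + 1 + (real d - 1) * 2 \<le> 2 * real d * real d"
      by (simp add: algebra_simps)
    moreover have "(real d + 1 / real d) + (real d - 1) / real d * 2
        = (real d * real d + 1 + (real d - 1) * 2) / real d"
      using d by (simp add: divide_simps)
    ultimately show ?thesis using d by (simp add: pos_divide_le_eq mult_ac)
  qed
  finally show ?thesis
    using d unfolding Nil nbhd_mean_dary_tree_root by (simp add: hit_weight_def field_simps)
next
  case (Cons i w)
  have "hit_weight d v w + (\<Sum>j<d. hit_weight d v (j # u)) \<le> hit_weight d v u * (real d + 1)"
  proof (cases "suffix u v")
    case True
    then have w: "suffix w v" unfolding Cons by (rule suffix_ConsD)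
    define x where "x = real d ^ length w"
    have x: "0 < x" using d by (simp add: x_def)
    have hu: "hit_weight d v u = real d * x + 1 / (real d * x)"
      using hit_weight_suffix[OF True d] by (simp add: Cons x_def)
    have hw: "hit_weight d v w = x + 1 / x"
      using hit_weight_suffix[OF w d] by (simp add: x_def)
    have "(\<Sum>j<d. hit_weight d v (j # u)) \<le> (real d * (real d * x) + 1 / (real d * (real d * x)))
        + (real d - 1) / real d * (real d * x + 1 / (real d * x))"
      using sum_hit_weight_children[OF d True] by (simp add: hu) (simp add: Cons x_def)
    \<comment> \<open>The coefficients of \<open>x\<close> agree because
      \<open>1 + d^2 + (d - 1) = d * (d + 1)\<close>; those of \<open>1 / x\<close> match
      likewise.\<close>
    also have "x + 1 / x + \<dots> = (real d * x + 1 / (real d * x)) * (real d + 1)"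
      using d x by (simp add: field_simps)
    finally show ?thesis unfolding hu hw by linarith
  next
    case False
    then have "\<not> suffix (j # u) v" for j by (meson suffix_ConsD)
    then have "(\<Sum>j<d. hit_weight d v (j # u)) = (\<Sum>j<d. hit_weight d v u / real d)"
      by (intro sum.cong refl hit_weight_Cons_not_suffix) auto
    also have "\<dots> = hit_weight d v u" using d by simp
    finally have children: "(\<Sum>j<d. hit_weight d v (j # u)) = hit_weight d v u" .
    have "hit_weight d v w = real d * hit_weight d v u"
      using hit_weight_Cons_not_suffix[of i w v d] False d unfolding Cons by simp
    then show ?thesis by (simp add: children algebra_simps)
  qed
  then show ?thesis
    using u unfolding Cons by (subst nbhd_mean_dary_tree_Cons) (auto simp: pos_divide_le_eq)
qed

text \<open>The pairing with \<open>hit_weight d v\<close> starts at its root value \<open>2\<close>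
  and never increases, while the weight at \<open>v\<close> is at least
  \<open>d ^ length v\<close>.\<close>

lemma reachable_mass_le:
  assumes d: "d \<ge> 2" and "(point_mass [], \<mu>) \<in> toppling_move (dary_tree d) ^^ k"
  shows "\<mu> v \<le> 2 / real d ^ length v"
proof -
  have fin0: "finite_mass (dary_tree d) (point_mass [])" by (rule finite_mass_point_mass) simp
  have fin: "finite_mass (dary_tree d) \<mu>"
    using dary.finite_mass_relpow[OF fin0 assms(2)] .
  have "real d ^ length v * \<mu> v \<le> hit_weight d v v * \<mu> v"
    using finite_massD(1)[OF fin, of v] hit_weight_suffix[OF suffix_order.refl d, of v]
    by (intro mult_right_mono) auto
  also have "\<dots> \<le> mass_pairing (hit_weight d v) \<mu>"
    by (rule mass_pairing_ge_single[OF fin hit_weight_nonneg])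
  also have "\<dots> \<le> mass_pairing (hit_weight d v) (point_mass [])"
    by (rule dary.superharmonic_relpow[OF fin0 assms(2)]) (simp add: nbhd_mean_hit_weight[OF d])
  also have "\<dots> = 2" by (simp add: mass_pairing_point_mass hit_weight_def)
  finally show ?thesis using d by (simp add: field_simps)
qed

section \<open>Flow of mass across the boundary of the ball\<close>

lemma nbhd_mean_outside:
  assumes d: "d \<ge> 2" and v: "v \<in> lists {..<d}" and f: "f = indicator {u. Suc n \<le> length u}"
  shows "nbhd_mean (dary_tree d) f v - f v \<le> (if length v = n then 1 else 0)"
proof -
  have le1: "nbhd_mean (dary_tree d) f v \<le> 1"
  proof -
    have "(\<Sum>y\<in>nbhd (dary_tree d) v. f y) \<le> real (card (nbhd (dary_tree d) v))"
      using sum_bounded_above[of "nbhd (dary_tree d) v" f 1] by (simp add: f indicator_def)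
    then show ?thesis by (auto simp: nbhd_mean_def divide_le_eq_1 simp del: card_0_eq)
  qed
  \<comment> \<open>A vertex of smaller depth than \<open>n\<close> has no neighbour beyond depth
    \<open>n\<close>; beyond depth \<open>n\<close> the value is already \<open>1\<close>, which no
    mean exceeds.\<close>
  consider "length v = n" | "length v > n" | "length v < n" by linarith
  then show ?thesis
  proof cases
    case 3
    then have "nbhd_mean (dary_tree d) f v = 0"
      using v by (cases v) (auto simp: nbhd_mean_dary_tree_root nbhd_mean_dary_tree_Cons f)
    then show ?thesis using 3 by (simp add: f)
  qed (use le1 in \<open>auto simp: f\<close>)
qed

text \<open>Only a move at depth \<open>n\<close> lets mass out, and it carries at most the mass of
  one vertex, bounded by \<open>reachable_mass_le\<close>.\<close>

lemma reachable_mass_outside_le: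
  assumes d: "d \<ge> 2" and "(point_mass [], \<mu>) \<in> toppling_move (dary_tree d) ^^ k"
  shows "mass_pairing (indicator {u. Suc n \<le> length u}) \<mu> \<le> real k * (2 / real d ^ n)"
  using assms(2)
proof (induction k arbitrary: \<mu>)
  case 0
  then have "\<mu> = point_mass []" by simp
  then show ?case by (simp add: mass_pairing_point_mass)
next
  case (Suc k)
  let ?f = "indicator {u. Suc n \<le> length u} :: nat list \<Rightarrow> real"
  have fin0: "finite_mass (dary_tree d) (point_mass [])" by (rule finite_mass_point_mass) simp
  obtain \<eta> where \<eta>: "(point_mass [], \<eta>) \<in> toppling_move (dary_tree d) ^^ k"
      "(\<eta>, \<mu>) \<in> toppling_move (dary_tree d)" using Suc.prems by auto
  then obtain v m where v: "v \<in> lists {..<d}" "0 < m" "m \<le> \<eta> v" "\<mu> = topple (dary_tree d) v m \<eta>"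
    by (auto simp: toppling_move_def)
  have "m * (nbhd_mean (dary_tree d) ?f v - ?f v) \<le> m * (if length v = n then 1 else 0)"
    using nbhd_mean_outside[OF d v(1) refl] v(2) by (intro mult_left_mono) auto
  also have "\<dots> \<le> 2 / real d ^ n"
    using reachable_mass_le[OF d \<eta>(1), of v] v(3) by auto
  finally have "m * (nbhd_mean (dary_tree d) ?f v - ?f v) \<le> 2 / real d ^ n" .
  moreover have "mass_pairing ?f \<mu> = mass_pairing ?f \<eta> - m * (?f v - nbhd_mean (dary_tree d) ?f v)"
    unfolding v(4) using v(1) finite_massD(3)[OF dary.finite_mass_relpow[OF fin0 \<eta>(1)]]
    by (intro dary.mass_pairing_topple(2)) auto
  moreover have "real (Suc k) * (2 / real d ^ n) = real k * (2 / real d ^ n) + 2 / real d ^ n"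
    by (simp only: of_nat_Suc distrib_right mult_1_left add.commute)
  ultimately show ?case using Suc.IH[OF \<eta>(1)] by (simp only: right_diff_distrib)
qed

text \<open>Stated for an arbitrary successful sequence of moves, so that it applies to a minimal
  one.\<close>

lemma toppling_number_ge:
  assumes d: "d \<ge> 2" and p: "0 < p" and n: "n \<ge> 1"
    and k: "(point_mass [], \<mu>) \<in> toppling_move (dary_tree d) ^^ k"
      "ennreal p \<le> mass_outside (dary_tree d) (open_ball (dary_tree d) [] n) \<mu>"
  shows "p / (2 * real d) * real d ^ n \<le> real k"
proof -
  \<comment> \<open>The outermost level of the ball is \<open>m = n - 1\<close>; this shift puts the
    factor \<open>d\<close> into the denominator of the constant.\<close>
  obtain m where m: "n = Suc m" using n by (cases n) auto
  have fin: "finite_mass (dary_tree d) \<mu>"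
    by (rule dary.finite_mass_relpow[OF finite_mass_point_mass k(1)]) simp
  have "ennreal p \<le> ennreal (mass_pairing (indicator (- open_ball (dary_tree d) [] n)) \<mu>)"
    using k(2) unfolding mass_outside_eq_pairing[OF fin] .
  then have "p \<le> mass_pairing (indicator (- open_ball (dary_tree d) [] n)) \<mu>"
    using p by (simp add: ennreal_le_iff2)
  also have "\<dots> \<le> mass_pairing (indicator {u. Suc m \<le> length u}) \<mu>"
    by (rule mass_pairing_mono[OF fin]) (auto simp: open_ball_dary_tree indicator_def m)
  also have "\<dots> \<le> real k * (2 / real d ^ m)" by (rule reachable_mass_outside_le[OF d k(1)])
  finally show ?thesis using d by (simp add: m field_simps)
qed

theorem theorem1p5:
  fixes d :: nat and p :: real
  assumes "d \<ge> 2" and "0 < p" and "p < 1"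
  shows "\<exists>(c::real) (C::real) (n0::nat). 0 < c \<and> c \<le> C \<and>
    (\<forall>n\<ge>n0.
      ereal (c * real d ^ n)
        \<le> ereal_of_enat (toppling_number p (dary_tree d)
             (open_ball (dary_tree d) tree_root n) (point_mass tree_root)) \<and>
      ereal_of_enat (toppling_number p (dary_tree d)
             (open_ball (dary_tree d) tree_root n) (point_mass tree_root))
        \<le> ereal (C * real d ^ n))"
proof -
  let ?N = "\<lambda>n. toppling_number p (dary_tree d) (open_ball (dary_tree d) tree_root n) (point_mass tree_root)"
  obtain s where "(17 / 18 :: real) ^ s < (1 - p) / 3"
    using real_arch_pow_inv[of "(1 - p) / 3" "17 / 18"] assms(3) by auto
  then have s: "(17 / 18 :: real) ^ s \<le> (1 - p) / 3" by simp
  \<comment> \<open>The summand \<open>1\<close> in \<open>?C\<close> secures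
    \<open>?c \<le> ?C\<close>, because \<open>?c \<le> 1\<close>.\<close>
  let ?c = "p / (2 * real d)" and ?C = "2 * real s + 1"
  have "?c \<le> 1" using assms by (simp add: divide_le_eq)
  then have c: "0 < ?c" "?c \<le> ?C" using assms by (simp, linarith)
  have "ereal (?c * real d ^ n) \<le> ereal_of_enat (?N n) \<and> ereal_of_enat (?N n) \<le> ereal (?C * real d ^ n)"
    if n: "n \<ge> 1" for n
  proof
    have le: "?N n \<le> enat (2 * s * d ^ n)" using toppling_number_le assms s by blast
    then obtain k where k: "?N n = enat k" using enat_ile by blast
    let ?K = "{enat k | k. \<exists>\<mu>. (point_mass tree_root, \<mu>) \<in> toppling_move (dary_tree d) ^^ k \<and>
      ennreal p \<le> mass_outside (dary_tree d) (open_ball (dary_tree d) tree_root n) \<mu>}"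
    have Inf_K: "?N n = Inf ?K" by (simp only: toppling_number_def)
    \<comment> \<open>The upper bound makes the infimum finite, so the set is nonempty and by
      well-ordering contains its infimum; the lower bound then applies to a minimal
      sequence.\<close>
    have "?K \<noteq> {}"
    proof
      assume "?K = {}"
      then have "?N n = Inf {}" using Inf_K by (simp only:)
      then show False using k by (simp add: top_enat_def)
    qed
    then obtain x where "x \<in> ?K" by blast
    then have "?N n \<in> ?K" unfolding Inf_K by (rule wellorder_InfI)
    then have "?c * real d ^ n \<le> real k"
      using toppling_number_ge[OF assms(1,2) n] by (auto simp: k)
    then show "ereal (?c * real d ^ n) \<le> ereal_of_enat (?N n)" by (simp add: k)
    have "k \<le> 2 * s * d ^ n" using le by (simp add: k)
    then have "real k \<le> real (2 * s * d ^ n)" by (simp only: of_nat_le_iff)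
    also have "\<dots> \<le> ?C * real d ^ n" by (simp add: algebra_simps)
    finally show "ereal_of_enat (?N n) \<le> ereal (?C * real d ^ n)" by (simp add: k)
  qed
  then show ?thesis using c by blast
qed

end
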